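(* Let $\Omega\subset\mathbb{R}^n$ be a bounded open domain and $0<\alpha<1$. Assume that $f:[0,\infty)\to\mathbb{R}$ is nonnegative, continuous and monotone non-decreasing on $[0,\infty)$, and that $g\in C^{0,\beta}(\partial\Omega)$ is nonnegative for some $0<\beta<\alpha$. Then there exists a nonnegative function $u\in C^{0,\beta}(\overline{\Omega})$ which is a viscosity solution of the obstacle problem $$\begin{cases} L[u]=f(u) & \text{in } \{u>0\},\\ u=g & \text{on } \partial\Omega.\end{cases}$$ Moreover, $u$ is locally $\alpha$-H\"older continuous in $\Omega$.
   Context: For $w:\overline{\Omega}\to\mathbb{R}$ and $x\in\Omega$ put $$L[w](x)=\sup_{y\in\overline{\Omega},\,y\ne x}\frac{w(y)-w(x)}{|y-x|^\alpha}+\inf_{y\in\overline{\Omega},\,y\ne x}\frac{w(y)-w(x)}{|y-x|^\alpha}.$$ For a nonnegative continuous $u:\overline{\Omega}\to\mathbb{R}$, let $\{u>0\}=\{x\in\Omega: u(x)>0\}$. "$u$ is a viscosity solution of $L[u]=f(u)$ in $\{u>0\}$" means: for every $\varphi\in C^1(\Omega)\cap C(\overline{\Omega})$ and every $x_0\in\{u>0\}$ with $u(x_0)=\varphi(x_0)$: (i) if $u\le\varphi$ on $\overline{\Omega}$ then $-L[\varphi](x_0)+f(\varphi(x_0))\le 0$; (ii) if $u\ge\varphi$ on $\overline{\Omega}$ then $-L[\varphi](x_0)+f(\varphi(x_0))\ge 0$. "Locally $\alpha$-H\"older" means $\alpha$-H\"older continuous on every $\omega\subset\subset\Omega$. *)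

theory Defs
  imports "HOL-Analysis.Analysis"
begin

text \<open>
  Functions on a subset of \<open>\<real>\<^sup>n\<close> are total functions of which only the values on that subset
  matter.  All sets below are bounded, so finiteness of the Hoelder seminorm already gives
  membership in \<open>C\<^sup>0\<^sup>,\<^sup>\<beta>\<close>.
\<close>

definition holder_on :: "real \<Rightarrow> (real ^ 'n) set \<Rightarrow> (real ^ 'n \<Rightarrow> real) \<Rightarrow> bool" where
  "holder_on \<beta> S u \<longleftrightarrow>
     (\<exists>C. \<forall>x\<in>S. \<forall>y\<in>S. \<bar>u x - u y\<bar> \<le> C * norm (x - y) powr \<beta>)"

definition locally_holder_on :: "real \<Rightarrow> (real ^ 'n) set \<Rightarrow> (real ^ 'n \<Rightarrow> real) \<Rightarrow> bool" where
  "locally_holder_on \<alpha> \<Omega> u \<longleftrightarrow>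
     (\<forall>\<omega>. compact (closure \<omega>) \<and> closure \<omega> \<subseteq> \<Omega> \<longrightarrow> holder_on \<alpha> \<omega> u)"

definition C1_on :: "(real ^ 'n) set \<Rightarrow> (real ^ 'n \<Rightarrow> real) \<Rightarrow> bool" where
  "C1_on \<Omega> \<phi> \<longleftrightarrow> (\<exists>G. continuous_on \<Omega> G \<and> (\<forall>x\<in>\<Omega>. GDERIV \<phi> x :> G x))"

text \<open>
  The supremum and infimum are taken in the reals and are meaningful only when the quotients are
  bounded.  For the test functions of the viscosity definition this always holds, see
  \<open>holder_quotient_bounded\<close>.
\<close>

definition holder_quotient :: "real \<Rightarrow> (real ^ 'n \<Rightarrow> real) \<Rightarrow> real ^ 'n \<Rightarrow> real ^ 'n \<Rightarrow> real" where
  "holder_quotient \<alpha> w x y = (w y - w x) / norm (y - x) powr \<alpha>"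

definition holder_inf_laplacian ::
    "real \<Rightarrow> (real ^ 'n) set \<Rightarrow> (real ^ 'n \<Rightarrow> real) \<Rightarrow> real ^ 'n \<Rightarrow> real" where
  "holder_inf_laplacian \<alpha> \<Omega> w x =
     (SUP y \<in> closure \<Omega> - {x}. holder_quotient \<alpha> w x y) +
     (INF y \<in> closure \<Omega> - {x}. holder_quotient \<alpha> w x y)"

lemma holder_quotient_bounded:
  fixes \<Omega> :: "(real ^ 'n) set"
  assumes "bounded \<Omega>" and \<alpha>: "0 < \<alpha>" "\<alpha> < 1"
    and C1: "C1_on \<Omega> \<phi>" and cont: "continuous_on (closure \<Omega>) \<phi>" and x: "x \<in> \<Omega>"
  shows "bounded (holder_quotient \<alpha> \<phi> x ` (closure \<Omega> - {x}))"
proof -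
  obtain v where "GDERIV \<phi> x :> v"
    using C1 x unfolding C1_on_def by blast
  then have "(\<phi> has_derivative (\<lambda>h. h \<bullet> v)) (at x)"
    by (simp add: gderiv_def)
  then obtain d where d: "d > 0"
    and near: "\<And>y. norm (y - x) < d \<Longrightarrow> \<bar>\<phi> y - \<phi> x - (y - x) \<bullet> v\<bar> \<le> 1 * norm (y - x)"
    unfolding has_derivative_at_alt real_norm_def by (meson zero_less_one)
  have "compact (\<phi> ` closure \<Omega>)"
    using assms(1) cont by (intro compact_continuous_image) auto
  then obtain M where M: "\<And>y. y \<in> closure \<Omega> \<Longrightarrow> \<bar>\<phi> y\<bar> \<le> M"
    by (force dest!: compact_imp_bounded simp: bounded_iff)
  define e where "e = min d 1"
  have e: "e > 0" "e \<le> d" "e \<le> 1" using d by (auto simp: e_def)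
  have "\<bar>holder_quotient \<alpha> \<phi> x y\<bar> \<le> max (1 + norm v) (2 * M / e powr \<alpha>)"
    if y: "y \<in> closure \<Omega>" "y \<noteq> x" for y
  proof (cases "norm (y - x) < e")
    case True
    let ?r = "norm (y - x)"
    have r: "0 < ?r" using y by simp
    have "\<bar>\<phi> y - \<phi> x\<bar> \<le> ?r + \<bar>(y - x) \<bullet> v\<bar>" using near[of y] True e by linarith
    also have "\<dots> \<le> (1 + norm v) * ?r"
      using Cauchy_Schwarz_ineq2[of "y - x" v] by (simp add: algebra_simps)
    also have "\<dots> \<le> (1 + norm v) * ?r powr \<alpha>"
      using powr_mono'[of \<alpha> 1 ?r] r True e \<alpha> by (intro mult_left_mono) auto
    finally show ?thesis using r by (simp add: holder_quotient_def field_simps le_max_iff_disj)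
  next
    case False
    then have "e powr \<alpha> \<le> norm (y - x) powr \<alpha>" using e \<alpha> by (intro powr_mono2) auto
    moreover have "\<bar>\<phi> y - \<phi> x\<bar> \<le> 2 * M"
      using M[OF y(1)] M[of x] x closure_subset[of \<Omega>] by fastforce
    ultimately have "\<bar>\<phi> y - \<phi> x\<bar> / norm (y - x) powr \<alpha> \<le> 2 * M / e powr \<alpha>"
      using e by (intro frac_le) auto
    then show ?thesis by (simp add: holder_quotient_def abs_divide le_max_iff_disj)
  qed
  then show ?thesis unfolding bounded_iff by auto
qed

definition positivity_set :: "(real ^ 'n) set \<Rightarrow> (real ^ 'n \<Rightarrow> real) \<Rightarrow> (real ^ 'n) set" where
  "positivity_set \<Omega> u = {x \<in> \<Omega>. u x > 0}"

definition viscosity_solution ::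
    "real \<Rightarrow> (real ^ 'n) set \<Rightarrow> (real \<Rightarrow> real) \<Rightarrow> (real ^ 'n \<Rightarrow> real) \<Rightarrow> bool" where
  "viscosity_solution \<alpha> \<Omega> f u \<longleftrightarrow>
     (\<forall>\<phi> x\<^sub>0. C1_on \<Omega> \<phi> \<and> continuous_on (closure \<Omega>) \<phi> \<and>
        x\<^sub>0 \<in> positivity_set \<Omega> u \<and> u x\<^sub>0 = \<phi> x\<^sub>0 \<longrightarrow>
        ((\<forall>x\<in>closure \<Omega>. u x \<le> \<phi> x) \<longrightarrow>
            - holder_inf_laplacian \<alpha> \<Omega> \<phi> x\<^sub>0 + f (\<phi> x\<^sub>0) \<le> 0) \<and>
        ((\<forall>x\<in>closure \<Omega>. u x \<ge> \<phi> x) \<longrightarrow>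
            - holder_inf_laplacian \<alpha> \<Omega> \<phi> x\<^sub>0 + f (\<phi> x\<^sub>0) \<ge> 0))"

end

theory Submission imports Defs begin

text \<open>
  The solution is Perron's: the pointwise supremum \<open>u\<close> of all nonnegative continuous subsolutions
  that lie below \<open>g\<close> on the boundary.  What makes the method work without any prior regularity is that
  cones are strict supersolutions.  For \<open>0 < \<gamma> \<le> \<alpha>\<close> and \<open>x \<noteq> p\<close> put \<open>r = \<bar>x - p\<bar>\<close>; the quotient of
  \<open>\<bar>y - p\<bar>\<^sup>\<gamma>\<close> between \<open>x\<close> and the vertex \<open>p\<close> equals \<open>- r powr (\<gamma> - \<alpha>)\<close>, whereas every quotient at \<open>x\<close> is at
  most \<open>c * r powr (\<gamma> - \<alpha>)\<close> with some \<open>c < 1\<close>, because \<open>(1 + t) powr \<gamma> - 1\<close> stays strictly below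
  \<open>t powr \<alpha>\<close> on bounded ranges of \<open>t\<close>.  So the operator is negative on such a cone away from its vertex
  (\<open>cone_laplacian_le\<close>), and since \<open>f \<ge> 0\<close>, a subsolution that lies below a nonnegative cone at the vertex and on
  the boundary lies below it everywhere (\<open>cone_comparison\<close>).

  All regularity follows by comparing the competitors with cones whose vertex value is \<open>u p\<close>.
  Exponent \<open>\<beta>\<close> with a vertex anywhere in the closure gives the global Hoelder estimate, and exponent \<open>\<alpha>\<close>
  with an interior vertex \<open>p\<close>, where a slope of order \<open>d powr (- \<alpha>)\<close> for \<open>d\<close> the distance from \<open>p\<close> to the
  boundary is needed to dominate \<open>g\<close>, gives the local one.  The truncated downward cones
  \<open>max 0 (g z - C * \<bar>y - z\<bar>\<^sup>\<beta>)\<close> are subsolutions for large \<open>C\<close> (\<open>barrier_slope\<close>).  It is here that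
  \<open>\<beta> < \<alpha>\<close> enters: then \<open>c\<close> is independent of \<open>r\<close>, and \<open>r powr (\<beta> - \<alpha>)\<close> is bounded below, so that a large
  slope beats the bounded right-hand side.  Hence \<open>u = g\<close> on the boundary.

  The equation for \<open>u\<close> comes from the usual two viscosity arguments.  A strict touching point of \<open>u\<close>
  from above is a limit of touching points of competitors, and if the supersolution property failed, \<open>u\<close>
  could be raised by a small bump.  Both need that a strict inequality for the operator at a point survives a
  small quadratic perturbation of the test function and a small displacement of the point
  (\<open>laplacian_less_perturb\<close>).

  Test functions are only asked to be Lipschitz near the touching point rather than \<open>C\<^sup>1\<close>.  As \<open>\<alpha> < 1\<close>,
  this already forces the quotients to vanish at the point, which is what continuity of the operator in the base point rests on; and it
  admits the cones, which are not differentiable at their vertex, as test functions at all other points.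
\<close>

section \<open>Elementary inequalities for powers\<close>

lemma powr_diff_le_tangent:
  fixes a b \<gamma> :: real
  assumes "0 < b" "b \<le> a" "0 < \<gamma>" "\<gamma> \<le> 1"
  shows "a powr \<gamma> - b powr \<gamma> \<le> \<gamma> * b powr (\<gamma> - 1) * (a - b)"
proof (cases "a = b")
  case False
  then have "b < a" using assms by simp
  then have "\<exists>z>b. z < a \<and> a powr \<gamma> - b powr \<gamma> = (a - b) * (\<gamma> * z powr (\<gamma> - 1))"
    using assms by (intro MVT2) (auto intro!: has_real_derivative_powr)
  then obtain z where z: "b < z" "z < a"
    and eq: "a powr \<gamma> - b powr \<gamma> = (a - b) * (\<gamma> * z powr (\<gamma> - 1))"
    by blast
  have "z powr (\<gamma> - 1) \<le> b powr (\<gamma> - 1)"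
    using assms z by (intro powr_mono2') auto
  then have "(a - b) * (\<gamma> * z powr (\<gamma> - 1)) \<le> (a - b) * (\<gamma> * b powr (\<gamma> - 1))"
    using assms by (intro mult_left_mono) auto
  then show ?thesis using eq by (simp add: algebra_simps)
qed simp

text \<open>
  For \<open>t \<le> 1\<close> concavity gives the factor \<open>\<gamma>\<close>, as \<open>(1 + t) powr \<gamma> - 1 \<le> \<gamma> * t\<close>.  For \<open>t \<ge> 1\<close>
  it gives \<open>(1 + t) powr \<gamma> - 1 \<le> t powr \<gamma> - (1 - \<gamma>)\<close>, and the fixed deficit \<open>1 - \<gamma>\<close> is a fixed
  fraction of \<open>t powr \<alpha>\<close> as long as \<open>t\<close> is bounded.  For \<open>\<gamma> = \<alpha>\<close> the bound on \<open>t\<close> cannot be dropped, since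
  the ratio of the two sides tends to 1 at infinity.
\<close>
lemma powr_increment_gap:
  fixes \<alpha> \<gamma> T :: real
  assumes "0 < \<gamma>" "\<gamma> \<le> \<alpha>" "\<alpha> < 1" "0 < T"
  obtains c where "0 < c" "c < 1" "\<And>t. 0 < t \<Longrightarrow> t \<le> T \<Longrightarrow> (1 + t) powr \<gamma> - 1 \<le> c * t powr \<alpha>"
proof -
  define c where "c = max \<gamma> (1 - (1 - \<gamma>) / T powr \<alpha>)"
  have c: "0 < c" "c < 1" using assms by (auto simp: c_def)
  have "(1 + t) powr \<gamma> - 1 \<le> c * t powr \<alpha>" if t: "0 < t" "t \<le> T" for t
  proof (cases "t \<le> 1")
    case True
    have "(1 + t) powr \<gamma> - 1 \<le> \<gamma> * t"
      using powr_diff_le_tangent[of 1 "1 + t" \<gamma>] assms t by simp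
    also have "\<dots> \<le> \<gamma> * t powr \<alpha>"
      using powr_mono'[of \<alpha> 1 t] assms t True by (intro mult_left_mono) auto
    also have "\<dots> \<le> c * t powr \<alpha>"
      by (intro mult_right_mono) (auto simp: c_def)
    finally show ?thesis .
  next
    case False
    have "(1 + t) powr \<gamma> - t powr \<gamma> \<le> \<gamma> * t powr (\<gamma> - 1)"
      using powr_diff_le_tangent[of t "1 + t" \<gamma>] assms t by simp
    also have "\<dots> \<le> \<gamma> * 1"
      using assms False powr_mono[of "\<gamma> - 1" 0 t] by (intro mult_left_mono) auto
    finally have "(1 + t) powr \<gamma> - 1 \<le> t powr \<gamma> - (1 - \<gamma>)" by simp
    also have "\<dots> \<le> t powr \<alpha> - (1 - \<gamma>)"
      using assms False by (simp add: powr_mono)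
    also have "\<dots> \<le> t powr \<alpha> - (1 - \<gamma>) * (t powr \<alpha> / T powr \<alpha>)"
    proof -
      have "t powr \<alpha> \<le> T powr \<alpha>" using assms t by (intro powr_mono2) auto
      then have "(1 - \<gamma>) * (t powr \<alpha> / T powr \<alpha>) \<le> (1 - \<gamma>) * 1"
        using assms by (intro mult_left_mono) auto
      then show ?thesis by simp
    qed
    also have "\<dots> = (1 - (1 - \<gamma>) / T powr \<alpha>) * t powr \<alpha>" by (simp add: algebra_simps)
    also have "\<dots> \<le> c * t powr \<alpha>"
      by (intro mult_right_mono) (auto simp: c_def)
    finally show ?thesis .
  qed
  with c show thesis using that by blast
qed

text \<open>
  When \<open>\<gamma> < \<alpha>\<close>, large \<open>t\<close> are harmless: there \<open>t powr \<gamma>\<close> is itself a small fraction of \<open>t powr \<alpha>\<close>.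
\<close>
lemma powr_increment_gap_uniform:
  fixes \<alpha> \<gamma> :: real
  assumes "0 < \<gamma>" "\<gamma> < \<alpha>" "\<alpha> < 1"
  obtains c where "0 < c" "c < 1" "\<And>t. 0 < t \<Longrightarrow> (1 + t) powr \<gamma> - 1 \<le> c * t powr \<alpha>"
proof -
  obtain c where c: "0 < c" "c < 1"
    and gap: "\<And>t. 0 < t \<Longrightarrow> t \<le> 2 \<Longrightarrow> (1 + t) powr \<gamma> - 1 \<le> c * t powr \<alpha>"
    using powr_increment_gap[of \<gamma> \<alpha> 2] assms by auto
  define c' where "c' = max c (2 powr (\<gamma> - \<alpha>))"
  have c': "0 < c'" "c' < 1"
    using c assms powr_less_mono[of "\<gamma> - \<alpha>" 0 2] by (auto simp: c'_def)
  have "(1 + t) powr \<gamma> - 1 \<le> c' * t powr \<alpha>" if t: "0 < t" for t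
  proof (cases "t \<le> 2")
    case True
    have "c * t powr \<alpha> \<le> c' * t powr \<alpha>" by (intro mult_right_mono) (auto simp: c'_def)
    with gap[OF t True] show ?thesis by linarith
  next
    case False
    have "(1 + t) powr \<gamma> - t powr \<gamma> \<le> \<gamma> * t powr (\<gamma> - 1)"
      using powr_diff_le_tangent[of t "1 + t" \<gamma>] assms t by simp
    also have "\<dots> \<le> 1 * 1"
      using assms False powr_mono[of "\<gamma> - 1" 0 t] by (intro mult_mono) auto
    finally have "(1 + t) powr \<gamma> - 1 \<le> t powr \<gamma>" by simp
    also have "\<dots> = t powr (\<gamma> - \<alpha>) * t powr \<alpha>" by (simp flip: powr_add)
    also have "\<dots> \<le> 2 powr (\<gamma> - \<alpha>) * t powr \<alpha>"
      using assms False by (intro mult_right_mono powr_mono2') auto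
    also have "\<dots> \<le> c' * t powr \<alpha>"
      by (intro mult_right_mono) (auto simp: c'_def)
    finally show ?thesis .
  qed
  with c' show thesis using that by blast
qed


section \<open>Functions that are Lipschitz near a point\<close>

definition lipschitz_near :: "('a::metric_space \<Rightarrow> 'b::metric_space) \<Rightarrow> 'a \<Rightarrow> bool" where
  "lipschitz_near \<phi> x \<longleftrightarrow> (\<exists>d>0. \<exists>B. B-lipschitz_on (ball x d) \<phi>)"

lemma lipschitz_near_open:
  assumes "lipschitz_near \<phi> x"
  obtains r where "0 < r" "\<And>y. y \<in> ball x r \<Longrightarrow> lipschitz_near \<phi> y"
proof -
  obtain d B where d: "d > 0" "B-lipschitz_on (ball x d) \<phi>"
    using assms by (auto simp: lipschitz_near_def)
  have "lipschitz_near \<phi> y" if "y \<in> ball x d" for y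
  proof -
    have "ball y (d - dist x y) \<subseteq> ball x d"
    proof
      fix w assume "w \<in> ball y (d - dist x y)"
      then show "w \<in> ball x d" using dist_triangle[of x w y] by simp
    qed
    moreover have "0 < d - dist x y" using that by simp
    ultimately show ?thesis
      using d(2) lipschitz_on_subset unfolding lipschitz_near_def by blast
  qed
  with d that show thesis by blast
qed

lemma lipschitz_near_add:
  fixes \<phi> \<psi> :: "'a::metric_space \<Rightarrow> 'b::real_normed_vector"
  assumes "lipschitz_near \<phi> x" "lipschitz_near \<psi> x"
  shows "lipschitz_near (\<lambda>y. \<phi> y + \<psi> y) x"
proof -
  obtain d B where d: "d > 0" "B-lipschitz_on (ball x d) \<phi>"
    using assms by (auto simp: lipschitz_near_def)
  obtain e C where e: "e > 0" "C-lipschitz_on (ball x e) \<psi>"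
    using assms by (auto simp: lipschitz_near_def)
  have "(B + C)-lipschitz_on (ball x (min d e)) (\<lambda>y. \<phi> y + \<psi> y)"
    using d e by (intro lipschitz_on_add lipschitz_on_subset[OF d(2)] lipschitz_on_subset[OF e(2)]) auto
  then show ?thesis using d e unfolding lipschitz_near_def by (meson min_less_iff_conj)
qed

lemma lipschitz_near_const: "lipschitz_near (\<lambda>_. c) x"
  unfolding lipschitz_near_def using zero_less_one lipschitz_on_constant by blast

lemma lipschitz_near_cmult:
  fixes \<phi> :: "'a::metric_space \<Rightarrow> real"
  assumes "lipschitz_near \<phi> x"
  shows "lipschitz_near (\<lambda>y. c * \<phi> y) x"
  using assms lipschitz_on_cmult_real[of _ _ \<phi> c] unfolding lipschitz_near_def by blast

lemma lipschitz_near_minus: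
  fixes \<phi> :: "'a::metric_space \<Rightarrow> real"
  assumes "lipschitz_near \<phi> x"
  shows "lipschitz_near (\<lambda>y. - \<phi> y) x"
  using lipschitz_near_cmult[OF assms, of "-1"] by simp

lemma lipschitz_near_if_C1_on:
  fixes \<Omega> :: "(real ^ 'n) set"
  assumes "open \<Omega>" "C1_on \<Omega> \<phi>" "x \<in> \<Omega>"
  shows "lipschitz_near \<phi> x"
proof -
  obtain G where G: "continuous_on \<Omega> G" "\<And>y. y \<in> \<Omega> \<Longrightarrow> GDERIV \<phi> y :> G y"
    using assms by (auto simp: C1_on_def)
  obtain d1 where d1: "d1 > 0" "ball x d1 \<subseteq> \<Omega>"
    using assms open_contains_ball by blast
  obtain d2 where d2: "d2 > 0" "\<And>y. y \<in> \<Omega> \<Longrightarrow> dist y x < d2 \<Longrightarrow> dist (G y) (G x) < 1"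
    using G(1) assms(3) unfolding continuous_on_iff by (meson zero_less_one)
  define d where "d = min d1 d2"
  have d: "d > 0" "ball x d \<subseteq> \<Omega>" using d1 d2 by (auto simp: d_def)
  have bound: "norm (G y) \<le> norm (G x) + 1" if "y \<in> ball x d" for y
  proof -
    have "dist (G y) (G x) < 1" using that d d2(2)[of y] by (auto simp: d_def dist_commute)
    then show ?thesis using norm_triangle_ineq2[of "G y" "G x"] by (simp add: dist_norm)
  qed
  have "(norm (G x) + 1)-lipschitz_on (ball x d) \<phi>"
  proof (rule bounded_derivative_imp_lipschitz)
    show "(\<phi> has_derivative (\<lambda>h. h \<bullet> G y)) (at y within ball x d)" if "y \<in> ball x d" for y
      using G(2)[of y] that d(2) has_derivative_at_withinI unfolding gderiv_def by blast
    show "onorm (\<lambda>h. h \<bullet> G y) \<le> norm (G x) + 1" if "y \<in> ball x d" for y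
    proof (rule onorm_le)
      fix h
      have "norm (h \<bullet> G y) \<le> norm h * norm (G y)" by (simp add: Cauchy_Schwarz_ineq2)
      also have "\<dots> \<le> norm h * (norm (G x) + 1)" by (intro mult_left_mono bound that) auto
      finally show "norm (h \<bullet> G y) \<le> (norm (G x) + 1) * norm h" by (simp add: mult.commute)
    qed
  qed auto
  then show ?thesis using d unfolding lipschitz_near_def by blast
qed

lemma lipschitz_near_dist_square:
  fixes p :: "'a::real_normed_vector"
  shows "lipschitz_near (\<lambda>y. (norm (y - p))\<^sup>2) x"
proof -
  define B where "B = 2 * (norm (x - p) + 1)"
  have "B-lipschitz_on (ball x 1) (\<lambda>y. (norm (y - p))\<^sup>2)"
  proof (rule lipschitz_onI)
    fix y z assume yz: "y \<in> ball x 1" "z \<in> ball x 1"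
    have near: "norm (w - p) \<le> norm (x - p) + 1" if "w \<in> ball x 1" for w
      using that norm_triangle_ineq[of "w - x" "x - p"] by (auto simp: dist_norm norm_minus_commute)
    have "(norm (y - p))\<^sup>2 - (norm (z - p))\<^sup>2
        = (norm (y - p) - norm (z - p)) * (norm (y - p) + norm (z - p))"
      by (simp add: power2_eq_square algebra_simps)
    then have "\<bar>(norm (y - p))\<^sup>2 - (norm (z - p))\<^sup>2\<bar>
        = \<bar>norm (y - p) - norm (z - p)\<bar> * (norm (y - p) + norm (z - p))"
      by (simp add: abs_mult)
    also have "\<dots> \<le> norm (y - z) * B"
      using norm_triangle_ineq3[of "y - p" "z - p"] near[OF yz(1)] near[OF yz(2)]
      by (intro mult_mono) (auto simp: B_def)
    finally show "dist ((norm (y - p))\<^sup>2) ((norm (z - p))\<^sup>2) \<le> B * dist y z"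
      by (simp add: dist_norm mult.commute)
  qed (simp add: B_def)
  then show ?thesis unfolding lipschitz_near_def using zero_less_one by blast
qed

lemma lipschitz_near_norm_powr:
  fixes p :: "'a::real_normed_vector"
  assumes "x \<noteq> p" "0 < \<gamma>" "\<gamma> \<le> 1"
  shows "lipschitz_near (\<lambda>y. norm (y - p) powr \<gamma>) x"
proof -
  define m where "m = norm (x - p) / 2"
  have m: "m > 0" using assms by (simp add: m_def)
  define B where "B = \<gamma> * m powr (\<gamma> - 1)"
  have one_sided: "norm (y - p) powr \<gamma> - norm (z - p) powr \<gamma> \<le> B * norm (y - z)"
    if z: "z \<in> ball x m" for y z
  proof (cases "norm (z - p) \<le> norm (y - p)")
    case True
    have far: "m \<le> norm (z - p)"
      using z norm_triangle_ineq[of "x - z" "z - p"] by (simp add: dist_norm m_def)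
    have "norm (y - p) powr \<gamma> - norm (z - p) powr \<gamma>
        \<le> \<gamma> * norm (z - p) powr (\<gamma> - 1) * (norm (y - p) - norm (z - p))"
      using far m assms True by (intro powr_diff_le_tangent) auto
    also have "\<dots> \<le> B * norm (y - z)"
      unfolding B_def
      using far m assms True norm_triangle_ineq2[of "y - p" "z - p"]
      by (intro mult_mono powr_mono2') auto
    finally show ?thesis .
  next
    case False
    then have "norm (y - p) powr \<gamma> \<le> norm (z - p) powr \<gamma>"
      using assms by (intro powr_mono2) auto
    moreover have "0 \<le> B * norm (y - z)" using assms by (simp add: B_def)
    ultimately show ?thesis by linarith
  qed
  have "B-lipschitz_on (ball x m) (\<lambda>y. norm (y - p) powr \<gamma>)"
  proof (rule lipschitz_onI)
    fix y z assume "y \<in> ball x m" "z \<in> ball x m"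
    then show "dist (norm (y - p) powr \<gamma>) (norm (z - p) powr \<gamma>) \<le> B * dist y z"
      using one_sided[of z y] one_sided[of y z]
      by (simp add: dist_norm abs_le_iff norm_minus_commute)
  qed (use assms in \<open>simp add: B_def\<close>)
  then show ?thesis using m unfolding lipschitz_near_def by blast
qed

lemma continuous_on_norm_powr:
  fixes p :: "'a::real_normed_vector"
  assumes "0 < \<gamma>"
  shows "continuous_on S (\<lambda>y. norm (y - p) powr \<gamma>)"
  using assms by (intro continuous_on_powr' continuous_on_norm continuous_on_diff continuous_on_id
      continuous_on_const) auto

text \<open>
  The only consequence of Lipschitz regularity that matters for the operator: since \<open>\<alpha> < 1\<close>, the Hoelder
  quotients between points near \<open>x\<close> are arbitrarily small, uniformly in both points.
\<close>
lemma small_holder_constant_if_lipschitz_near: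
  fixes \<phi> :: "'a::real_normed_vector \<Rightarrow> real"
  assumes "lipschitz_near \<phi> x" "\<alpha> < 1" "0 < e"
  obtains d where "0 < d"
    "\<And>y z. y \<in> ball x d \<Longrightarrow> z \<in> ball x d \<Longrightarrow> \<bar>\<phi> y - \<phi> z\<bar> \<le> e * norm (y - z) powr \<alpha>"
proof -
  obtain d0 B where d0: "d0 > 0" and lip: "B-lipschitz_on (ball x d0) \<phi>"
    using assms by (auto simp: lipschitz_near_def)
  have B: "0 \<le> B" using lip lipschitz_on_nonneg by blast
  define \<rho> where "\<rho> = (e / (B + 1)) powr (1 / (1 - \<alpha>))"
  have \<rho>: "\<rho> > 0" using assms B by (simp add: \<rho>_def)
  have \<rho>_eq: "\<rho> powr (1 - \<alpha>) = e / (B + 1)" using assms B by (simp add: \<rho>_def powr_powr)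
  define d where "d = min d0 (\<rho> / 2)"
  have "\<bar>\<phi> y - \<phi> z\<bar> \<le> e * norm (y - z) powr \<alpha>" if yz: "y \<in> ball x d" "z \<in> ball x d" for y z
  proof (cases "y = z")
    case False
    have "norm (y - z) \<le> norm (y - x) + norm (x - z)"
      using norm_triangle_ineq[of "y - x" "x - z"] by simp
    then have small: "norm (y - z) \<le> \<rho>"
      using yz by (simp add: d_def dist_norm norm_minus_commute)
    have "\<bar>\<phi> y - \<phi> z\<bar> \<le> B * norm (y - z)"
      using lipschitz_onD[OF lip, of y z] yz by (simp add: d_def dist_norm)
    also have "norm (y - z) = norm (y - z) powr (1 - \<alpha>) * norm (y - z) powr \<alpha>"
      using False by (simp flip: powr_add)
    also have "B * \<dots> \<le> (B + 1) * (\<rho> powr (1 - \<alpha>) * norm (y - z) powr \<alpha>)"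
      using small B assms by (intro mult_mono[OF _ mult_right_mono[OF powr_mono2]]) auto
    also have "\<dots> = e * norm (y - z) powr \<alpha>" using B by (simp add: \<rho>_eq)
    finally show ?thesis .
  qed simp
  moreover have "d > 0" using d0 \<rho> by (simp add: d_def)
  ultimately show thesis using that by blast
qed


section \<open>The operator on functions that are Lipschitz near the point\<close>

locale holder_domain =
  fixes \<Omega> :: "(real ^ 'n) set" and \<alpha> :: real
  assumes open_domain: "open \<Omega>" and bounded_domain: "bounded \<Omega>" and nonempty_domain: "\<Omega> \<noteq> {}"
    and \<alpha>: "0 < \<alpha>" "\<alpha> < 1"
begin

abbreviation Q where "Q \<equiv> holder_quotient \<alpha>"
abbreviation L where "L \<equiv> holder_inf_laplacian \<alpha> \<Omega>"

definition test_at :: "(real ^ 'n \<Rightarrow> real) \<Rightarrow> real ^ 'n \<Rightarrow> bool" where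
  "test_at \<phi> x \<longleftrightarrow> x \<in> \<Omega> \<and> continuous_on (closure \<Omega>) \<phi> \<and> lipschitz_near \<phi> x"

lemma compact_closure_domain: "compact (closure \<Omega>)"
  using bounded_domain by simp

lemma domain_in_closure: "x \<in> \<Omega> \<Longrightarrow> x \<in> closure \<Omega>"
  using closure_subset by blast

lemma frontier_in_closure: "x \<in> frontier \<Omega> \<Longrightarrow> x \<in> closure \<Omega>"
  by (simp add: frontier_def)

lemma domain_not_frontier: "x \<in> \<Omega> \<Longrightarrow> x \<notin> frontier \<Omega>"
  using open_domain by (simp add: frontier_def interior_open)

lemma closure_cases: "x \<in> closure \<Omega> \<Longrightarrow> x \<in> \<Omega> \<or> x \<in> frontier \<Omega>"
  using open_domain by (auto simp: frontier_def interior_open)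

lemma frontier_nonempty: "frontier \<Omega> \<noteq> {}"
  using nonempty_domain bounded_domain frontier_not_empty[of \<Omega>] not_bounded_UNIV by blast

lemma diameter_bound:
  obtains D where "D > 0" "\<And>x y. x \<in> closure \<Omega> \<Longrightarrow> y \<in> closure \<Omega> \<Longrightarrow> norm (x - y) \<le> D"
proof -
  obtain D where "D > 0" "\<And>x. x \<in> closure \<Omega> \<Longrightarrow> norm x \<le> D"
    using bounded_closure[OF bounded_domain] bounded_pos by blast
  then have "norm (x - y) \<le> 2 * D" if "x \<in> closure \<Omega>" "y \<in> closure \<Omega>" for x y
    using that norm_triangle_ineq4[of x y] by (smt (verit))
  with \<open>D > 0\<close> that[of "2 * D"] show thesis by simp
qed

lemma test_at_add: "test_at \<phi> x \<Longrightarrow> test_at \<psi> x \<Longrightarrow> test_at (\<lambda>y. \<phi> y + \<psi> y) x"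
  by (auto simp: test_at_def intro: lipschitz_near_add continuous_on_add)

lemma test_at_minus: "test_at \<phi> x \<Longrightarrow> test_at (\<lambda>y. - \<phi> y) x"
  by (auto simp: test_at_def intro: lipschitz_near_minus continuous_on_minus)

lemma test_at_cmult: "test_at \<phi> x \<Longrightarrow> test_at (\<lambda>y. c * \<phi> y) x"
  by (auto simp: test_at_def intro: lipschitz_near_cmult continuous_on_mult_left)

lemma test_at_const: "x \<in> \<Omega> \<Longrightarrow> test_at (\<lambda>_. c) x"
  by (auto simp: test_at_def intro: lipschitz_near_const)

lemma test_at_dist_square: "x \<in> \<Omega> \<Longrightarrow> test_at (\<lambda>y. (norm (y - p))\<^sup>2) x"
  by (auto simp: test_at_def intro!: lipschitz_near_dist_square continuous_intros)

lemma test_at_cone: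
  assumes "x \<in> \<Omega>" "x \<noteq> p" "0 < \<gamma>" "\<gamma> \<le> 1"
  shows "test_at (\<lambda>y. a + K * norm (y - p) powr \<gamma>) x"
proof -
  have "test_at (\<lambda>y. norm (y - p) powr \<gamma>) x"
    using assms by (auto simp: test_at_def intro!: lipschitz_near_norm_powr continuous_on_norm_powr)
  then show ?thesis
    using assms by (intro test_at_add test_at_cmult test_at_const) auto
qed

lemma quotient_bounded:
  assumes "test_at \<phi> x"
  obtains M where "M > 0" "\<And>y. y \<in> closure \<Omega> - {x} \<Longrightarrow> \<bar>Q \<phi> x y\<bar> \<le> M"
proof -
  obtain d where d: "d > 0"
    and near: "\<And>y z. y \<in> ball x d \<Longrightarrow> z \<in> ball x d \<Longrightarrow> \<bar>\<phi> y - \<phi> z\<bar> \<le> 1 * norm (y - z) powr \<alpha>"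
    using small_holder_constant_if_lipschitz_near[of \<phi> x \<alpha> 1] assms \<alpha> unfolding test_at_def by auto
  have "compact (\<phi> ` closure \<Omega>)"
    using assms compact_closure_domain by (auto simp: test_at_def intro: compact_continuous_image)
  then obtain M where M: "\<And>y. y \<in> closure \<Omega> \<Longrightarrow> \<bar>\<phi> y\<bar> \<le> M"
    by (force dest!: compact_imp_bounded simp: bounded_iff)
  have x: "x \<in> closure \<Omega>" using assms domain_in_closure by (auto simp: test_at_def)
  have "\<bar>Q \<phi> x y\<bar> \<le> max 1 (2 * M / d powr \<alpha>)" if y: "y \<in> closure \<Omega> - {x}" for y
  proof (cases "y \<in> ball x d")
    case True
    then show ?thesis
      using near[of y x] d y by (simp add: holder_quotient_def abs_divide field_simps le_max_iff_disj)
  next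
    case False
    then have "d powr \<alpha> \<le> norm (y - x) powr \<alpha>"
      using d \<alpha> by (intro powr_mono2) (auto simp: dist_norm norm_minus_commute)
    moreover have "\<bar>\<phi> y - \<phi> x\<bar> \<le> 2 * M"
      using M[of y] M[OF x] y by simp
    ultimately have "\<bar>\<phi> y - \<phi> x\<bar> / norm (y - x) powr \<alpha> \<le> 2 * M / d powr \<alpha>"
      using d by (intro frac_le) auto
    then show ?thesis by (simp add: holder_quotient_def abs_divide le_max_iff_disj)
  qed
  then show thesis using that[of "max 1 (2 * M / d powr \<alpha>)"] by simp
qed

lemma point_nearby:
  assumes "x \<in> \<Omega>" "0 < d"
  obtains y where "y \<in> closure \<Omega> - {x}" "y \<in> ball x d"
proof -
  have "x islimpt \<Omega>" using assms open_domain by (simp add: interior_limit_point interior_open)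
  then obtain y where "y \<in> \<Omega>" "y \<noteq> x" "dist y x < d"
    using assms unfolding islimpt_approachable by blast
  then show thesis using that[of y] domain_in_closure by (auto simp: dist_commute)
qed

text \<open>
  A description of strict sublevels that is free of suprema and infima; all later estimates of the operator go through it.
  The bound \<open>a\<close> may be taken nonnegative because quotients against nearby points tend to 0, so that their
  supremum is never negative.
\<close>
lemma laplacian_less_iff:
  assumes "test_at \<phi> x"
  shows "L \<phi> x < c \<longleftrightarrow>
    (\<exists>a\<ge>0. \<exists>y0\<in>closure \<Omega> - {x}. (\<forall>y\<in>closure \<Omega> - {x}. Q \<phi> x y \<le> a) \<and> a + Q \<phi> x y0 < c)"
proof -
  let ?A = "closure \<Omega> - {x}"
  have x: "x \<in> \<Omega>" using assms by (simp add: test_at_def)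
  obtain M where M: "\<And>y. y \<in> ?A \<Longrightarrow> \<bar>Q \<phi> x y\<bar> \<le> M"
    using quotient_bounded[OF assms] by blast
  have above: "bdd_above (Q \<phi> x ` ?A)" using M by (intro bdd_aboveI2[of _ _ M]) force
  have below: "bdd_below (Q \<phi> x ` ?A)" using M by (intro bdd_belowI2[of _ "- M"]) force
  have ne: "?A \<noteq> {}" using point_nearby[OF x zero_less_one] by blast
  show ?thesis
  proof
    assume less: "L \<phi> x < c"
    define a where "a = (SUP y\<in>?A. Q \<phi> x y)"
    have a: "Q \<phi> x y \<le> a" if "y \<in> ?A" for y
      unfolding a_def using above that by (rule cSUP_upper2) simp
    have "0 \<le> a"
    proof (rule field_le_epsilon)
      fix e :: real assume "0 < e"
      then obtain d where d: "d > 0"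
        and near: "\<And>y z. y \<in> ball x d \<Longrightarrow> z \<in> ball x d \<Longrightarrow> \<bar>\<phi> y - \<phi> z\<bar> \<le> e * norm (y - z) powr \<alpha>"
        using small_holder_constant_if_lipschitz_near[of \<phi> x \<alpha> e] assms \<alpha> unfolding test_at_def by auto
      obtain y where y: "y \<in> ?A" "y \<in> ball x d" using point_nearby[OF x d] .
      have "\<bar>Q \<phi> x y\<bar> \<le> e"
        using near[of y x] y d by (simp add: holder_quotient_def abs_divide field_simps)
      with a[OF y(1)] show "0 \<le> a + e" by linarith
    qed
    moreover have "\<exists>y0\<in>?A. Q \<phi> x y0 < c - a"
      using less cINF_less_iff[OF ne below, of "c - a"] by (simp add: holder_inf_laplacian_def a_def)
    ultimately show "\<exists>a\<ge>0. \<exists>y0\<in>?A. (\<forall>y\<in>?A. Q \<phi> x y \<le> a) \<and> a + Q \<phi> x y0 < c"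
      using a by (smt (verit))
  next
    assume "\<exists>a\<ge>0. \<exists>y0\<in>?A. (\<forall>y\<in>?A. Q \<phi> x y \<le> a) \<and> a + Q \<phi> x y0 < c"
    then obtain a y0 where a: "y0 \<in> ?A" "\<And>y. y \<in> ?A \<Longrightarrow> Q \<phi> x y \<le> a" "a + Q \<phi> x y0 < c" by blast
    have "(SUP y\<in>?A. Q \<phi> x y) \<le> a" using ne a by (intro cSUP_least) auto
    moreover have "(INF y\<in>?A. Q \<phi> x y) \<le> Q \<phi> x y0" using a below by (intro cINF_lower) auto
    ultimately show "L \<phi> x < c" using a by (simp add: holder_inf_laplacian_def)
  qed
qed

lemma laplacian_le:
  assumes "test_at \<phi> x" "0 \<le> a" "\<And>y. y \<in> closure \<Omega> - {x} \<Longrightarrow> Q \<phi> x y \<le> a" "y0 \<in> closure \<Omega> - {x}"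
  shows "L \<phi> x \<le> a + Q \<phi> x y0"
proof (rule dense_ge)
  fix c assume "a + Q \<phi> x y0 < c"
  then have "L \<phi> x < c" using assms laplacian_less_iff[OF assms(1)] by blast
  then show "L \<phi> x \<le> c" by simp
qed

text \<open>
  Degenerate ellipticity: raising a function away from \<open>x\<close> raises every quotient at \<open>x\<close>.
\<close>
lemma laplacian_mono:
  assumes "test_at \<phi> x" "test_at \<psi> x" "\<phi> x = \<psi> x" "\<And>y. y \<in> closure \<Omega> \<Longrightarrow> \<phi> y \<le> \<psi> y"
  shows "L \<phi> x \<le> L \<psi> x"
proof (rule dense_ge)
  fix c assume "L \<psi> x < c"
  then obtain a y0 where a: "a \<ge> 0" "y0 \<in> closure \<Omega> - {x}"
    "\<And>y. y \<in> closure \<Omega> - {x} \<Longrightarrow> Q \<psi> x y \<le> a" "a + Q \<psi> x y0 < c"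
    using laplacian_less_iff[OF assms(2)] by blast
  have Q: "Q \<phi> x y \<le> Q \<psi> x y" if "y \<in> closure \<Omega> - {x}" for y
    using assms that by (auto simp: holder_quotient_def intro!: divide_right_mono)
  have "L \<phi> x \<le> a + Q \<phi> x y0"
    using a Q by (intro laplacian_le assms(1)) (auto intro: order_trans)
  also have "\<dots> \<le> c" using Q[OF a(2)] a(4) by linarith
  finally show "L \<phi> x \<le> c" .
qed

lemma laplacian_minus: "L (\<lambda>y. - \<phi> y) x = - L \<phi> x"
proof -
  have "Q (\<lambda>y. - \<phi> y) x = (\<lambda>y. - Q \<phi> x y)"
    by (auto simp: holder_quotient_def fun_eq_iff diff_divide_distrib)
  then show ?thesis
    by (simp add: holder_inf_laplacian_def Inf_real_def image_image)
qed

lemma laplacian_add_const: "L (\<lambda>y. \<phi> y + c) x = L \<phi> x"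
  by (simp add: holder_inf_laplacian_def holder_quotient_def)

text \<open>
  When the base point moves, the quotients against points at distance at least \<open>d\<close> change uniformly little by
  compactness, and those against nearer points are small by the Lipschitz property, hence below the
  nonnegative upper bound plus \<open>e\<close>.  The choice \<open>d \<le> dist x y0\<close> puts the witness \<open>y0\<close> of the infimum among the
  distant points.
\<close>
lemma laplacian_upper_semicontinuous:
  assumes "test_at \<phi> x" "L \<phi> x < c"
  obtains r where "0 < r" "\<And>x'. x' \<in> ball x r \<Longrightarrow> test_at \<phi> x' \<and> L \<phi> x' < c"
proof -
  have x: "x \<in> \<Omega>" and cont: "continuous_on (closure \<Omega>) \<phi>" and lip: "lipschitz_near \<phi> x"
    using assms by (auto simp: test_at_def)
  obtain a y0 where a: "a \<ge> 0" "y0 \<in> closure \<Omega> - {x}"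
    "\<And>y. y \<in> closure \<Omega> - {x} \<Longrightarrow> Q \<phi> x y \<le> a" "a + Q \<phi> x y0 < c"
    using laplacian_less_iff[OF assms(1)] assms(2) by blast
  define e where "e = (c - a - Q \<phi> x y0) / 2"
  have e: "e > 0" using a by (simp add: e_def)
  obtain d0 where d0: "d0 > 0"
    and near0: "\<And>y z. y \<in> ball x d0 \<Longrightarrow> z \<in> ball x d0 \<Longrightarrow> \<bar>\<phi> y - \<phi> z\<bar> \<le> e * norm (y - z) powr \<alpha>"
    using small_holder_constant_if_lipschitz_near[OF lip \<alpha>(2) e] by blast
  define d where "d = min d0 (dist x y0)"
  have d: "d > 0" "d \<le> d0" "d \<le> dist x y0" using d0 a by (auto simp: d_def)
  obtain r0 where r0: "r0 > 0" "ball x r0 \<subseteq> \<Omega>" using open_domain x open_contains_ball by blast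
  obtain r1 where r1: "r1 > 0" "\<And>y. y \<in> ball x r1 \<Longrightarrow> lipschitz_near \<phi> y"
    using lipschitz_near_open[OF lip] by blast
  define \<rho> where "\<rho> = min (r0 / 2) (d / 2)"
  have \<rho>: "\<rho> > 0" "\<rho> < d" "cball x \<rho> \<subseteq> \<Omega>"
    using d r0 by (auto simp: \<rho>_def)
  let ?K = "closure \<Omega> - ball x d"
  have K: "compact ?K" using compact_closure_domain by (simp add: compact_diff)
  have y0K: "y0 \<in> ?K" using a d by auto
  have sub: "cball x \<rho> \<subseteq> closure \<Omega>" using \<rho> closure_subset by blast
  have "continuous_on (cball x \<rho> \<times> ?K) (\<lambda>p. Q \<phi> (fst p) (snd p))"
    unfolding holder_quotient_def
  proof (intro continuous_on_divide continuous_on_diff continuous_on_powr' continuous_on_norm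
      continuous_on_fst continuous_on_snd continuous_on_id continuous_on_const ballI)
    show "continuous_on (cball x \<rho> \<times> ?K) (\<lambda>p. \<phi> (snd p))"
      by (rule continuous_on_compose2[OF cont]) (auto intro: continuous_on_snd)
    show "continuous_on (cball x \<rho> \<times> ?K) (\<lambda>p. \<phi> (fst p))"
      by (rule continuous_on_compose2[OF cont]) (use sub in \<open>auto intro: continuous_on_fst\<close>)
  qed (use \<rho> \<alpha> in auto)
  then have "uniformly_continuous_on (cball x \<rho> \<times> ?K) (\<lambda>p. Q \<phi> (fst p) (snd p))"
    using K by (intro compact_uniformly_continuous compact_Times) auto
  then obtain \<delta> where \<delta>: "\<delta> > 0" and unif: "\<And>p q. p \<in> cball x \<rho> \<times> ?K \<Longrightarrow> q \<in> cball x \<rho> \<times> ?K \<Longrightarrow>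
      dist q p < \<delta> \<Longrightarrow> dist (Q \<phi> (fst q) (snd q)) (Q \<phi> (fst p) (snd p)) < e"
    using e unfolding uniformly_continuous_on_def by meson
  define r where "r = min (min \<delta> \<rho>) r1"
  have far: "\<bar>Q \<phi> x' y - Q \<phi> x y\<bar> < e" if "x' \<in> ball x r" "y \<in> ?K" for x' y
  proof -
    have "dist (x', y) (x, y) < \<delta>" using that by (simp add: r_def dist_Pair_Pair dist_commute)
    then show ?thesis
      using unif[of "(x, y)" "(x', y)"] that \<rho> by (auto simp: r_def dist_real_def)
  qed
  have "test_at \<phi> x' \<and> L \<phi> x' < c" if x': "x' \<in> ball x r" for x'
  proof -
    have t: "test_at \<phi> x'" using x' cont r1 \<rho> by (auto simp: test_at_def r_def)
    have "Q \<phi> x' y \<le> a + e" if y: "y \<in> closure \<Omega> - {x'}" for y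
    proof (cases "y \<in> ball x d")
      case True
      then have "\<bar>\<phi> y - \<phi> x'\<bar> \<le> e * norm (y - x') powr \<alpha>"
        using x' d \<rho> by (intro near0) (auto simp: r_def)
      then have "\<bar>Q \<phi> x' y\<bar> \<le> e"
        using y by (simp add: holder_quotient_def abs_divide field_simps)
      then show ?thesis using a by linarith
    next
      case False
      then have "y \<in> ?K" "y \<noteq> x" using y d by auto
      then show ?thesis using far[OF x', of y] a(3)[of y] y by auto
    qed
    moreover have "y0 \<noteq> x'" using x' y0K \<rho> by (auto simp: r_def)
    moreover have "a + e + Q \<phi> x' y0 < c"
    proof -
      have "Q \<phi> x' y0 < Q \<phi> x y0 + e" using far[OF x' y0K] by linarith
      moreover have "2 * e = c - a - Q \<phi> x y0" by (simp add: e_def)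
      ultimately show ?thesis by linarith
    qed
    moreover have "0 \<le> a + e" using a e by linarith
    ultimately have "L \<phi> x' < c"
      using laplacian_less_iff[OF t, of c] y0K by blast
    with t show ?thesis by blast
  qed
  moreover have "r > 0" using \<delta> \<rho> r1 by (simp add: r_def)
  ultimately show thesis using that by blast
qed

text \<open>
  The quadratic term makes the touching at \<open>x\<close> strict, which is what localises maxima in the viscosity
  arguments.  Its quotients at \<open>x\<close> are bounded by some \<open>M\<close>, so it moves the operator at \<open>x\<close> by at
  most \<open>2 * \<eta> * M\<close>.
\<close>
lemma laplacian_less_perturb:
  assumes "test_at \<phi> x" "L \<phi> x < c"
  obtains \<eta> r where "0 < \<eta>" "0 < r"
    "\<And>x'. x' \<in> ball x r \<Longrightarrow> test_at (\<lambda>y. \<phi> y + \<eta> * (norm (y - x))\<^sup>2) x' \<and>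
        L (\<lambda>y. \<phi> y + \<eta> * (norm (y - x))\<^sup>2) x' < c"
proof -
  have x: "x \<in> \<Omega>" using assms by (simp add: test_at_def)
  let ?q = "\<lambda>y. (norm (y - x))\<^sup>2"
  obtain a y0 where a: "a \<ge> 0" "y0 \<in> closure \<Omega> - {x}"
    "\<And>y. y \<in> closure \<Omega> - {x} \<Longrightarrow> Q \<phi> x y \<le> a" "a + Q \<phi> x y0 < c"
    using laplacian_less_iff[OF assms(1)] assms(2) by blast
  obtain M where M: "M > 0" "\<And>y. y \<in> closure \<Omega> - {x} \<Longrightarrow> \<bar>Q ?q x y\<bar> \<le> M"
    using quotient_bounded[OF test_at_dist_square[OF x]] by blast
  define \<eta> where "\<eta> = (c - a - Q \<phi> x y0) / (3 * M)"
  have \<eta>: "\<eta> > 0" "\<eta> * M = (c - a - Q \<phi> x y0) / 3" using a M by (auto simp: \<eta>_def)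
  let ?\<psi> = "\<lambda>y. \<phi> y + \<eta> * ?q y"
  have t: "test_at ?\<psi> x" by (intro test_at_add test_at_cmult test_at_dist_square assms x)
  have Q: "Q ?\<psi> x y \<le> Q \<phi> x y + \<eta> * M" if "y \<in> closure \<Omega> - {x}" for y
  proof -
    have "Q ?\<psi> x y = Q \<phi> x y + \<eta> * Q ?q x y"
      by (simp add: holder_quotient_def add_divide_distrib diff_divide_distrib)
    then show ?thesis using M(2)[OF that] \<eta> by (simp add: abs_le_iff)
  qed
  have "L ?\<psi> x \<le> (a + \<eta> * M) + Q ?\<psi> x y0"
  proof (rule laplacian_le[OF t _ _ a(2)])
    show "0 \<le> a + \<eta> * M" using a(1) \<eta>(1) M(1) by simp
    show "Q ?\<psi> x y \<le> a + \<eta> * M" if "y \<in> closure \<Omega> - {x}" for y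
      using Q[OF that] a(3)[OF that] by (rule order_trans[OF _ add_right_mono])
  qed
  also have "\<dots> \<le> (a + \<eta> * M) + (Q \<phi> x y0 + \<eta> * M)"
    by (intro add_left_mono Q a(2))
  also have "\<dots> < c" using \<eta>(2) a(4) by (simp add: field_simps)
  finally obtain r where "r > 0" "\<And>x'. x' \<in> ball x r \<Longrightarrow> test_at ?\<psi> x' \<and> L ?\<psi> x' < c"
    using laplacian_upper_semicontinuous[OF t] by blast
  then show thesis using that \<eta> by blast
qed

lemma laplacian_greater_perturb:
  assumes "test_at \<phi> x" "c < L \<phi> x"
  obtains \<eta> r where "0 < \<eta>" "0 < r"
    "\<And>x'. x' \<in> ball x r \<Longrightarrow> test_at (\<lambda>y. \<phi> y - \<eta> * (norm (y - x))\<^sup>2) x' \<and>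
        c < L (\<lambda>y. \<phi> y - \<eta> * (norm (y - x))\<^sup>2) x'"
proof -
  have less: "L (\<lambda>y. - \<phi> y) x < - c" using assms by (simp add: laplacian_minus)
  obtain \<eta> r where *: "0 < \<eta>" "0 < r"
    "\<And>x'. x' \<in> ball x r \<Longrightarrow> test_at (\<lambda>y. - \<phi> y + \<eta> * (norm (y - x))\<^sup>2) x' \<and>
        L (\<lambda>y. - \<phi> y + \<eta> * (norm (y - x))\<^sup>2) x' < - c"
    using laplacian_less_perturb[OF test_at_minus[OF assms(1)] less] by blast
  have eq: "(\<lambda>y. \<phi> y - \<eta> * (norm (y - x))\<^sup>2) = (\<lambda>y. - (- \<phi> y + \<eta> * (norm (y - x))\<^sup>2))"
    by auto
  have "test_at (\<lambda>y. \<phi> y - \<eta> * (norm (y - x))\<^sup>2) x' \<and> c < L (\<lambda>y. \<phi> y - \<eta> * (norm (y - x))\<^sup>2) x'"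
    if "x' \<in> ball x r" for x'
  proof
    show "test_at (\<lambda>y. \<phi> y - \<eta> * (norm (y - x))\<^sup>2) x'"
      unfolding eq using *(3)[OF that] by (intro test_at_minus) simp
    show "c < L (\<lambda>y. \<phi> y - \<eta> * (norm (y - x))\<^sup>2) x'"
      unfolding eq laplacian_minus using *(3)[OF that] by linarith
  qed
  with * show thesis using that by blast
qed

text \<open>
  The infimum is controlled by the quotient against the vertex \<open>p\<close>, and the supremum by the hypothesis \<open>gap\<close>,
  which is the power inequality of the first section at \<open>t = \<bar>y - x\<bar> / \<bar>x - p\<bar>\<close>, after
  \<open>\<bar>y - p\<bar> \<le> \<bar>x - p\<bar> * (1 + t)\<close>.
\<close>
lemma cone_laplacian_le:
  assumes x: "x \<in> \<Omega>" and p: "p \<in> closure \<Omega>" "p \<noteq> x" and \<gamma>: "0 < \<gamma>" "\<gamma> \<le> 1" and K: "0 \<le> K" and c: "0 \<le> c"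
    and gap: "\<And>y. y \<in> closure \<Omega> - {x} \<Longrightarrow>
      (1 + norm (y - x) / norm (x - p)) powr \<gamma> - 1 \<le> c * (norm (y - x) / norm (x - p)) powr \<alpha>"
  shows "L (\<lambda>y. a + K * norm (y - p) powr \<gamma>) x \<le> - (K * (1 - c) * norm (x - p) powr (\<gamma> - \<alpha>))"
proof -
  let ?r = "norm (x - p)" and ?\<phi> = "\<lambda>y. a + K * norm (y - p) powr \<gamma>"
  have r: "?r > 0" using p by simp
  have t: "test_at ?\<phi> x" using assms by (intro test_at_cone) auto
  have "Q ?\<phi> x y \<le> K * c * ?r powr (\<gamma> - \<alpha>)" if y: "y \<in> closure \<Omega> - {x}" for y
  proof -
    let ?s = "norm (y - x)"
    have s: "?s > 0" using y by simp
    have "norm (y - p) \<le> ?r * (1 + ?s / ?r)"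
    proof -
      have "?r * (1 + ?s / ?r) = ?r + ?s" using r by (simp add: distrib_left)
      then show ?thesis using norm_triangle_ineq[of "y - x" "x - p"] by simp
    qed
    then have "norm (y - p) powr \<gamma> \<le> (?r * (1 + ?s / ?r)) powr \<gamma>"
      using \<gamma> by (intro powr_mono2) auto
    also have "\<dots> = ?r powr \<gamma> * (1 + ?s / ?r) powr \<gamma>"
      using r s by (intro powr_mult)
    finally have "norm (y - p) powr \<gamma> - ?r powr \<gamma> \<le> ?r powr \<gamma> * ((1 + ?s / ?r) powr \<gamma> - 1)"
      by (simp add: algebra_simps)
    also have "\<dots> \<le> ?r powr \<gamma> * (c * (?s / ?r) powr \<alpha>)"
      by (intro mult_left_mono gap y) simp
    also have "\<dots> = c * ?r powr (\<gamma> - \<alpha>) * ?s powr \<alpha>"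
      using r s by (simp add: powr_divide powr_diff)
    finally have "K * (norm (y - p) powr \<gamma> - ?r powr \<gamma>) \<le> K * (c * ?r powr (\<gamma> - \<alpha>) * ?s powr \<alpha>)"
      using K by (intro mult_left_mono)
    then show ?thesis using s by (simp add: holder_quotient_def pos_divide_le_eq algebra_simps)
  qed
  then have "L ?\<phi> x \<le> K * c * ?r powr (\<gamma> - \<alpha>) + Q ?\<phi> x p"
    using t K c p by (intro laplacian_le) auto
  also have "Q ?\<phi> x p = - (K * ?r powr (\<gamma> - \<alpha>))"
    using r \<gamma> by (simp add: holder_quotient_def powr_diff norm_minus_commute)
  finally show ?thesis by (simp add: algebra_simps)
qed

end


section \<open>Subsolutions and the Perron class\<close>

locale holder_obstacle = holder_domain \<Omega> \<alpha> for \<Omega> :: "(real ^ 'n) set" and \<alpha> :: real +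
  fixes \<beta> :: real and f :: "real \<Rightarrow> real" and g :: "real ^ 'n \<Rightarrow> real"
  assumes f_nonneg: "\<And>t. 0 \<le> t \<Longrightarrow> 0 \<le> f t" and f_cont: "continuous_on {0..} f"
    and f_mono: "mono_on {0..} f" and \<beta>: "0 < \<beta>" "\<beta> < \<alpha>"
    and g_holder: "holder_on \<beta> (frontier \<Omega>) g" and g_nonneg: "\<And>x. x \<in> frontier \<Omega> \<Longrightarrow> 0 \<le> g x"
begin

definition subsolution :: "(real ^ 'n \<Rightarrow> real) \<Rightarrow> bool" where
  "subsolution v \<longleftrightarrow> (\<forall>\<phi> x. test_at \<phi> x \<and> 0 < v x \<and> \<phi> x = v x \<and> (\<forall>y\<in>closure \<Omega>. v y \<le> \<phi> y)
     \<longrightarrow> f (v x) \<le> L \<phi> x)"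

definition perron_class :: "(real ^ 'n \<Rightarrow> real) set" where
  "perron_class = {v. continuous_on (closure \<Omega>) v \<and> (\<forall>x\<in>closure \<Omega>. 0 \<le> v x) \<and>
     (\<forall>x\<in>frontier \<Omega>. v x \<le> g x) \<and> subsolution v}"

definition perron_solution :: "real ^ 'n \<Rightarrow> real" where
  "perron_solution x = (SUP v\<in>perron_class. v x)"

text \<open>
  The operator ignores additive constants, so touching from above can be replaced by a maximum of the
  difference.
\<close>
lemma subsolution_max_touch:
  assumes v: "v \<in> perron_class" and \<phi>: "test_at \<phi> x" and max: "\<And>y. y \<in> closure \<Omega> \<Longrightarrow> v y - \<phi> y \<le> v x - \<phi> x"
    and pos: "0 < v x"
  shows "f (v x) \<le> L \<phi> x"
proof -
  have "f (v x) \<le> L (\<lambda>y. \<phi> y + (v x - \<phi> x)) x"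
  proof -
    have "test_at (\<lambda>y. \<phi> y + (v x - \<phi> x)) x"
      using \<phi> by (intro test_at_add test_at_const) (auto simp: test_at_def)
    moreover have "\<forall>y\<in>closure \<Omega>. v y \<le> \<phi> y + (v x - \<phi> x)" using max by force
    ultimately show ?thesis using v pos unfolding perron_class_def subsolution_def by force
  qed
  then show ?thesis by (simp only: laplacian_add_const)
qed

text \<open>
  At a positive maximum of \<open>v\<close> minus the cone, the cone (up to a constant) touches \<open>v\<close> from above at a point that is
  neither on the boundary nor the vertex.  There the operator would have to be at least \<open>f (v y) \<ge> 0\<close>, yet it
  is negative on the cone.  As \<open>0 \<le> a\<close>, the point lies in the positivity set, where the subsolution property is
  available.
\<close>
lemma cone_comparison:
  assumes v: "v \<in> perron_class" and p: "p \<in> closure \<Omega>" and \<gamma>: "0 < \<gamma>" "\<gamma> \<le> \<alpha>" and K: "0 < K" and a: "0 \<le> a"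
    and vertex: "v p \<le> a" and bdry: "\<And>y. y \<in> frontier \<Omega> \<Longrightarrow> v y \<le> a + K * norm (y - p) powr \<gamma>"
    and x: "x \<in> closure \<Omega>"
  shows "v x \<le> a + K * norm (x - p) powr \<gamma>"
proof (rule ccontr)
  assume neg: "\<not> ?thesis"
  let ?\<phi> = "\<lambda>y. a + K * norm (y - p) powr \<gamma>"
  have "continuous_on (closure \<Omega>) (\<lambda>y. v y - ?\<phi> y)"
    using v \<gamma> unfolding perron_class_def
    by (intro continuous_on_diff continuous_on_add continuous_on_mult continuous_on_const
        continuous_on_norm_powr) auto
  moreover have "closure \<Omega> \<noteq> {}" using nonempty_domain by simp
  ultimately obtain y where y: "y \<in> closure \<Omega>"
    and max: "\<And>z. z \<in> closure \<Omega> \<Longrightarrow> v z - ?\<phi> z \<le> v y - ?\<phi> y"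
    using continuous_attains_sup[OF compact_closure_domain, of "\<lambda>y. v y - ?\<phi> y"] by auto
  have gt: "v y > ?\<phi> y" using neg max[OF x] by simp
  have y\<Omega>: "y \<in> \<Omega>" using closure_cases[OF y] bdry[of y] gt by auto
  have yp: "p \<noteq> y" using gt vertex by auto
  have "0 \<le> K * norm (y - p) powr \<gamma>" using K by simp
  then have pos: "0 < v y" using gt a by linarith
  have t: "test_at ?\<phi> y" using y\<Omega> yp \<gamma> \<alpha> by (intro test_at_cone) auto
  have nonneg: "0 \<le> L ?\<phi> y"
    using subsolution_max_touch[OF v t max pos] f_nonneg[of "v y"] pos by linarith
  obtain D where D: "D > 0" "\<And>x y. x \<in> closure \<Omega> \<Longrightarrow> y \<in> closure \<Omega> \<Longrightarrow> norm (x - y) \<le> D"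
    using diameter_bound by blast
  have r: "norm (y - p) > 0" using yp by simp
  obtain c where c: "0 < c" "c < 1"
    and gap: "\<And>t. 0 < t \<Longrightarrow> t \<le> D / norm (y - p) \<Longrightarrow> (1 + t) powr \<gamma> - 1 \<le> c * t powr \<alpha>"
    using powr_increment_gap[of \<gamma> \<alpha> "D / norm (y - p)"] \<gamma> \<alpha> D r by auto
  have "L ?\<phi> y \<le> - (K * (1 - c) * norm (y - p) powr (\<gamma> - \<alpha>))"
    using y\<Omega> p yp \<gamma> \<alpha> K c D y r
    by (intro cone_laplacian_le gap) (auto intro!: divide_right_mono)
  also have "\<dots> < 0" using K c r by simp
  finally show False using nonneg by simp
qed

lemma zero_in_perron_class: "(\<lambda>_. 0) \<in> perron_class"
  using g_nonneg by (auto simp: perron_class_def subsolution_def)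

text \<open>
  Any test function touching the truncated cone from above at a point of positivity lies above the
  untruncated cone \<open>g z - C * \<bar>y - z\<bar>\<^sup>\<beta>\<close> and touches it too, so by monotonicity it is enough to evaluate the operator on
  that cone.  The value is at least \<open>C * \<kappa>\<close>, and \<open>C\<close> is chosen such that this is at least \<open>f M\<close>, where
  \<open>M\<close> bounds \<open>g\<close> and hence the truncated cone.
\<close>
lemma barrier_slope:
  "\<exists>C>0. (\<forall>y\<in>frontier \<Omega>. \<forall>z\<in>frontier \<Omega>. g y \<le> g z + C * norm (y - z) powr \<beta>) \<and>
     (\<forall>z\<in>frontier \<Omega>. (\<lambda>y. max 0 (g z - C * norm (y - z) powr \<beta>)) \<in> perron_class)"
proof -
  obtain C0 where C0: "\<And>y z. y \<in> frontier \<Omega> \<Longrightarrow> z \<in> frontier \<Omega> \<Longrightarrow> \<bar>g y - g z\<bar> \<le> C0 * norm (y - z) powr \<beta>"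
    using g_holder unfolding holder_on_def by blast
  obtain D where D: "D > 0" "\<And>x y. x \<in> closure \<Omega> \<Longrightarrow> y \<in> closure \<Omega> \<Longrightarrow> norm (x - y) \<le> D"
    using diameter_bound by blast
  obtain z0 where z0: "z0 \<in> frontier \<Omega>" using frontier_nonempty by blast
  define M where "M = g z0 + \<bar>C0\<bar> * D powr \<beta>"
  have M: "g z \<le> M" if "z \<in> frontier \<Omega>" for z
  proof -
    have "C0 * norm (z - z0) powr \<beta> \<le> \<bar>C0\<bar> * D powr \<beta>"
      using D z0 that \<beta> by (intro mult_mono powr_mono2) (auto intro: frontier_in_closure)
    then show ?thesis using C0[OF that z0] by (simp add: M_def)
  qed
  have M0: "M \<ge> 0" using M[OF z0] g_nonneg[OF z0] by linarith
  obtain c where c: "0 < c" "c < 1" and gap: "\<And>t. 0 < t \<Longrightarrow> (1 + t) powr \<beta> - 1 \<le> c * t powr \<alpha>"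
    using powr_increment_gap_uniform[of \<beta> \<alpha>] \<beta> \<alpha> by auto
  define \<kappa> where "\<kappa> = (1 - c) * D powr (\<beta> - \<alpha>)"
  have \<kappa>: "\<kappa> > 0" using c D by (simp add: \<kappa>_def)
  define C where "C = max (max 1 C0) (f M / \<kappa>)"
  have C: "C > 0" "C0 \<le> C" "f M \<le> C * \<kappa>"
    using \<kappa> by (auto simp: C_def pos_divide_le_eq[symmetric])
  have slope: "g y \<le> g z + C * norm (y - z) powr \<beta>" if "y \<in> frontier \<Omega>" "z \<in> frontier \<Omega>" for y z
  proof -
    have "C0 * norm (y - z) powr \<beta> \<le> C * norm (y - z) powr \<beta>" using C by (intro mult_right_mono) auto
    then show ?thesis using C0[OF that] by linarith
  qed
  have "(\<lambda>y. max 0 (g z - C * norm (y - z) powr \<beta>)) \<in> perron_class" (is "?v \<in> _") if z: "z \<in> frontier \<Omega>" for z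
  proof -
    have "f (?v x) \<le> L \<phi> x" if t: "test_at \<phi> x" and pos: "0 < ?v x" and eq: "\<phi> x = ?v x"
      and le: "\<forall>y\<in>closure \<Omega>. ?v y \<le> \<phi> y" for \<phi> x
    proof -
      have x: "x \<in> \<Omega>" using t by (simp add: test_at_def)
      have zx: "z \<noteq> x" using x z domain_not_frontier by blast
      let ?\<psi> = "\<lambda>y. - (- g z + C * norm (y - z) powr \<beta>)"
      have t\<psi>: "test_at ?\<psi> x" using x zx \<beta> \<alpha> by (intro test_at_minus test_at_cone) auto
      have vx: "?v x = g z - C * norm (x - z) powr \<beta>" using pos by auto
      have "f (?v x) \<le> f M"
      proof (rule mono_onD[OF f_mono])
        have "0 \<le> C * norm (x - z) powr \<beta>" using C by simp
        then show "?v x \<le> M" using M[OF z] vx by linarith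
      qed (use M0 pos in auto)
      also have "\<dots> \<le> C * ((1 - c) * D powr (\<beta> - \<alpha>))" using C by (simp add: \<kappa>_def)
      also have "\<dots> \<le> C * ((1 - c) * norm (x - z) powr (\<beta> - \<alpha>))"
        using C c D \<beta> zx x z
        by (intro mult_left_mono powr_mono2') (auto intro: frontier_in_closure domain_in_closure)
      also have "\<dots> \<le> L ?\<psi> x"
      proof -
        have "L (\<lambda>y. - g z + C * norm (y - z) powr \<beta>) x \<le> - (C * (1 - c) * norm (x - z) powr (\<beta> - \<alpha>))"
          using x z zx \<beta> \<alpha> C c by (intro cone_laplacian_le gap) (auto intro: frontier_in_closure)
        then show ?thesis unfolding laplacian_minus by (simp add: mult.assoc)
      qed
      also have "\<dots> \<le> L \<phi> x"
        using le by (intro laplacian_mono t t\<psi>) (auto simp: eq vx)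
      finally show ?thesis .
    qed
    then have "subsolution ?v" unfolding subsolution_def by blast
    moreover have "continuous_on (closure \<Omega>) ?v"
      using \<beta> by (intro continuous_on_max continuous_on_diff continuous_on_mult continuous_on_const
          continuous_on_norm_powr) auto
    moreover have "?v y \<le> g y" if "y \<in> frontier \<Omega>" for y
      using slope[OF z that] g_nonneg[OF that] by (simp add: norm_minus_commute)
    ultimately show ?thesis by (simp add: perron_class_def)
  qed
  with C(1) slope show ?thesis by (intro exI[of _ C] conjI ballI) auto
qed


section \<open>Regularity and boundary values of the Perron solution\<close>

lemma perron_class_uniform_bound:
  obtains M where "0 < M" "\<And>v x. v \<in> perron_class \<Longrightarrow> x \<in> closure \<Omega> \<Longrightarrow> v x \<le> M"
proof -
  obtain C where C: "0 < C" "\<forall>y\<in>frontier \<Omega>. \<forall>z\<in>frontier \<Omega>. g y \<le> g z + C * norm (y - z) powr \<beta>"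
    using barrier_slope by auto
  obtain D where D: "D > 0" "\<And>x y. x \<in> closure \<Omega> \<Longrightarrow> y \<in> closure \<Omega> \<Longrightarrow> norm (x - y) \<le> D"
    using diameter_bound by blast
  obtain z where z: "z \<in> frontier \<Omega>" using frontier_nonempty by blast
  have "v x \<le> g z + C * D powr \<beta>" if v: "v \<in> perron_class" and x: "x \<in> closure \<Omega>" for v x
  proof -
    have "v x \<le> g z + C * norm (x - z) powr \<beta>"
    proof (rule cone_comparison[OF v])
      show "v y \<le> g z + C * norm (y - z) powr \<beta>" if "y \<in> frontier \<Omega>" for y
      proof -
        have "v y \<le> g y" using v that by (simp add: perron_class_def)
        also have "\<dots> \<le> g z + C * norm (y - z) powr \<beta>" using C(2) that z by blast
        finally show ?thesis .
      qed
    qed (use v z x C \<beta> g_nonneg in \<open>auto simp: perron_class_def frontier_in_closure\<close>)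
    also have "\<dots> \<le> g z + C * D powr \<beta>"
      using C(1) D(2)[OF x frontier_in_closure[OF z]] \<beta>
      by (intro add_left_mono mult_left_mono powr_mono2) auto
    finally show ?thesis .
  qed
  moreover have "0 < g z + C * D powr \<beta>" using C D g_nonneg[OF z] by (simp add: add_nonneg_pos)
  ultimately show thesis using that by blast
qed

lemma le_perron_solution:
  assumes "v \<in> perron_class" "x \<in> closure \<Omega>"
  shows "v x \<le> perron_solution x"
proof -
  obtain M where "\<And>v. v \<in> perron_class \<Longrightarrow> v x \<le> M" using perron_class_uniform_bound assms by metis
  then show ?thesis
    unfolding perron_solution_def using assms by (intro cSUP_upper bdd_aboveI2[of _ _ M]) auto
qed

lemma perron_solution_le:
  assumes "\<And>v. v \<in> perron_class \<Longrightarrow> v x \<le> m"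
  shows "perron_solution x \<le> m"
  unfolding perron_solution_def using zero_in_perron_class assms by (intro cSUP_least) auto

lemma perron_solution_nonneg: "x \<in> closure \<Omega> \<Longrightarrow> 0 \<le> perron_solution x"
  using le_perron_solution[OF zero_in_perron_class] by simp

lemma perron_solution_le_boundary: "x \<in> frontier \<Omega> \<Longrightarrow> perron_solution x \<le> g x"
  by (intro perron_solution_le) (auto simp: perron_class_def)

lemma perron_solution_boundary:
  assumes "x \<in> frontier \<Omega>"
  shows "perron_solution x = g x"
proof -
  obtain C where "(\<lambda>y. max 0 (g x - C * norm (y - x) powr \<beta>)) \<in> perron_class"
    using barrier_slope assms by auto
  from le_perron_solution[OF this frontier_in_closure[OF assms]] have "g x \<le> perron_solution x" by simp
  with perron_solution_le_boundary[OF assms] show ?thesis by simp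
qed

text \<open>
  Each competitor \<open>v\<close> satisfies \<open>v p \<le> u p\<close> for the supremum \<open>u\<close>, so one cone with vertex value \<open>u p\<close> bounds all
  of them at once; this is how the estimate passes to the supremum.
\<close>
lemma perron_solution_cone:
  assumes p: "p \<in> closure \<Omega>" and x: "x \<in> closure \<Omega>" and \<gamma>: "0 < \<gamma>" "\<gamma> \<le> \<alpha>" and K: "0 < K"
    and bdry: "\<And>y. y \<in> frontier \<Omega> \<Longrightarrow> g y \<le> perron_solution p + K * norm (y - p) powr \<gamma>"
  shows "perron_solution x \<le> perron_solution p + K * norm (x - p) powr \<gamma>"
proof (rule perron_solution_le)
  fix v assume v: "v \<in> perron_class"
  show "v x \<le> perron_solution p + K * norm (x - p) powr \<gamma>"
  proof (rule cone_comparison[OF v p \<gamma> K _ _ _ x])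
    show "v y \<le> perron_solution p + K * norm (y - p) powr \<gamma>" if "y \<in> frontier \<Omega>" for y
      using bdry[OF that] v that by (force simp: perron_class_def)
  qed (use le_perron_solution[OF v p] perron_solution_nonneg[OF p] in auto)
qed

text \<open>
  The lower barriers give \<open>u p \<ge> g y - C * \<bar>p - y\<bar>\<^sup>\<beta>\<close> for all boundary points \<open>y\<close>, which is precisely the boundary
  condition needed to compare with the cone at \<open>p\<close>.
\<close>
lemma perron_solution_holder: "holder_on \<beta> (closure \<Omega>) perron_solution"
proof -
  obtain C where C: "0 < C"
    and barrier: "\<And>z. z \<in> frontier \<Omega> \<Longrightarrow> (\<lambda>y. max 0 (g z - C * norm (y - z) powr \<beta>)) \<in> perron_class"
    using barrier_slope by auto
  have *: "perron_solution x \<le> perron_solution p + C * norm (x - p) powr \<beta>"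
    if "x \<in> closure \<Omega>" "p \<in> closure \<Omega>" for x p
  proof (rule perron_solution_cone)
    show "g y \<le> perron_solution p + C * norm (y - p) powr \<beta>" if "y \<in> frontier \<Omega>" for y
      using le_perron_solution[OF barrier[OF that] \<open>p \<in> closure \<Omega>\<close>] by (simp add: norm_minus_commute)
  qed (use that C \<beta> in auto)
  have "\<bar>perron_solution x - perron_solution y\<bar> \<le> C * norm (x - y) powr \<beta>"
    if "x \<in> closure \<Omega>" "y \<in> closure \<Omega>" for x y
    using *[of x y] *[of y x] that by (simp add: norm_minus_commute)
  then show ?thesis unfolding holder_on_def by blast
qed

lemma perron_solution_continuous: "continuous_on (closure \<Omega>) perron_solution"
proof -
  obtain C where C: "\<And>x y. x \<in> closure \<Omega> \<Longrightarrow> y \<in> closure \<Omega> \<Longrightarrow>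
      \<bar>perron_solution x - perron_solution y\<bar> \<le> C * norm (x - y) powr \<beta>"
    using perron_solution_holder unfolding holder_on_def by blast
  show ?thesis
    unfolding continuous_on_def
  proof
    fix x assume x: "x \<in> closure \<Omega>"
    have "((\<lambda>y. C * norm (y - x) powr \<beta>) \<longlongrightarrow> C * norm (x - x) powr \<beta>) (at x within closure \<Omega>)"
      using \<beta> by (intro tendsto_intros tendsto_powr2) (auto intro!: always_eventually)
    then have "((\<lambda>y. C * norm (y - x) powr \<beta>) \<longlongrightarrow> 0) (at x within closure \<Omega>)" by simp
    then have "((\<lambda>y. perron_solution y - perron_solution x) \<longlongrightarrow> 0) (at x within closure \<Omega>)"
      by (rule Lim_null_comparison[rotated])
        (use C x in \<open>auto simp: eventually_at_filter intro!: always_eventually\<close>)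
    then show "(perron_solution \<longlongrightarrow> perron_solution x) (at x within closure \<Omega>)"
      by (simp add: Lim_null[symmetric])
  qed
qed

text \<open>
  For vertices at distance at least \<open>d\<close> from the boundary, the slope \<open>M / d powr \<alpha>\<close> lifts every cone above the
  common bound \<open>M\<close> of the competitors on the boundary.
\<close>
lemma perron_solution_locally_holder: "locally_holder_on \<alpha> \<Omega> perron_solution"
  unfolding locally_holder_on_def
proof (intro allI impI)
  fix \<omega> assume \<omega>: "compact (closure \<omega>) \<and> closure \<omega> \<subseteq> \<Omega>"
  then have "closure \<omega> \<inter> frontier \<Omega> = {}" using domain_not_frontier by blast
  then obtain d where d: "d > 0" "\<And>x y. x \<in> closure \<omega> \<Longrightarrow> y \<in> frontier \<Omega> \<Longrightarrow> d \<le> dist x y"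
    using separate_compact_closed[of "closure \<omega>" "frontier \<Omega>"] \<omega> by auto
  obtain M where M: "0 < M" "\<And>v x. v \<in> perron_class \<Longrightarrow> x \<in> closure \<Omega> \<Longrightarrow> v x \<le> M"
    using perron_class_uniform_bound by blast
  have in_dom: "x \<in> closure \<Omega>" "x \<in> closure \<omega>" if "x \<in> \<omega>" for x
    using that \<omega> closure_subset domain_in_closure by blast+
  define K where "K = M / d powr \<alpha>"
  have K: "K > 0" using M d by (simp add: K_def)
  have *: "perron_solution x \<le> perron_solution p + K * norm (x - p) powr \<alpha>"
    if "x \<in> \<omega>" "p \<in> \<omega>" for x p
  proof (rule perron_solution_cone)
    fix y assume y: "y \<in> frontier \<Omega>"
    have "g y \<le> M"
      using perron_solution_boundary[OF y] perron_solution_le[of y M] M(2) frontier_in_closure[OF y] by simp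
    also have "\<dots> = K * d powr \<alpha>" using d by (simp add: K_def)
    also have "\<dots> \<le> K * norm (y - p) powr \<alpha>"
      using d(1) d(2)[OF in_dom(2)[OF that(2)] y] K \<alpha>
      by (intro mult_left_mono powr_mono2) (auto simp: dist_norm norm_minus_commute)
    finally show "g y \<le> perron_solution p + K * norm (y - p) powr \<alpha>"
      using perron_solution_nonneg[OF in_dom(1)[OF that(2)]] by simp
  qed (use that in_dom K \<alpha> in auto)
  have "\<bar>perron_solution x - perron_solution y\<bar> \<le> K * norm (x - y) powr \<alpha>" if "x \<in> \<omega>" "y \<in> \<omega>" for x y
    using *[of x y] *[of y x] that by (simp add: norm_minus_commute)
  then show "holder_on \<alpha> \<omega> perron_solution" unfolding holder_on_def by blast
qed


section \<open>The Perron solution solves the equation\<close>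

lemma f_near:
  assumes "0 < t" "0 < e"
  obtains d where "0 < d" "d \<le> t" "\<And>s. \<bar>s - t\<bar> < d \<Longrightarrow> \<bar>f s - f t\<bar> < e"
proof -
  obtain d where d: "d > 0" "\<And>s. s \<in> {0..} \<Longrightarrow> dist s t < d \<Longrightarrow> dist (f s) (f t) < e"
    using f_cont assms unfolding continuous_on_iff by (meson atLeast_iff less_imp_le)
  have "\<bar>f s - f t\<bar> < e" if "\<bar>s - t\<bar> < min d t" for s
    using that d(2)[of s] by (auto simp: dist_real_def)
  then show thesis using d assms that[of "min d t"] by simp
qed

text \<open>
  Suppose the operator is below \<open>c < f (u x)\<close> on the quadratically perturbed test function \<open>\<psi>\<close> near \<open>x\<close>.  Take a
  competitor \<open>v\<close> with \<open>v x\<close> within \<open>\<tau>\<close> of \<open>u x\<close>.  The maximum of \<open>v - \<psi>\<close> is attained close to \<open>x\<close>, at a point \<open>y\<close>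
  with \<open>v y\<close> close to \<open>u x\<close>, and the subsolution property of \<open>v\<close> at \<open>y\<close> contradicts the continuity of \<open>f\<close>.
\<close>
lemma perron_solution_subsolution: "subsolution perron_solution"
  unfolding subsolution_def
proof (intro allI impI, elim conjE)
  fix \<phi> x
  let ?u = perron_solution
  assume t: "test_at \<phi> x" and pos: "0 < ?u x" and eq: "\<phi> x = ?u x" and le: "\<forall>y\<in>closure \<Omega>. ?u y \<le> \<phi> y"
  have x: "x \<in> \<Omega>" "x \<in> closure \<Omega>" and cont: "continuous_on (closure \<Omega>) \<phi>"
    using t domain_in_closure by (auto simp: test_at_def)
  show "f (?u x) \<le> L \<phi> x"
  proof (rule ccontr)
    assume "\<not> ?thesis"
    then obtain c where c: "L \<phi> x < c" "c < f (?u x)" using dense[of "L \<phi> x" "f (?u x)"] by auto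
    obtain \<eta> r where \<eta>: "0 < \<eta>" and r: "0 < r"
      and near: "\<And>x'. x' \<in> ball x r \<Longrightarrow> test_at (\<lambda>y. \<phi> y + \<eta> * (norm (y - x))\<^sup>2) x' \<and>
        L (\<lambda>y. \<phi> y + \<eta> * (norm (y - x))\<^sup>2) x' < c"
      using laplacian_less_perturb[OF t c(1)] by blast
    let ?\<psi> = "\<lambda>y. \<phi> y + \<eta> * (norm (y - x))\<^sup>2"
    obtain d where d: "0 < d" "d \<le> ?u x" "\<And>s. \<bar>s - ?u x\<bar> < d \<Longrightarrow> \<bar>f s - f (?u x)\<bar> < f (?u x) - c"
      using f_near[OF pos, of "f (?u x) - c"] c by auto
    obtain \<delta> where \<delta>: "\<delta> > 0"
      "\<And>y. y \<in> closure \<Omega> \<Longrightarrow> dist y x < \<delta> \<Longrightarrow> dist (\<phi> y) (\<phi> x) < d / 2"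
      using cont x d(1) unfolding continuous_on_iff by (meson half_gt_zero)
    define \<rho> where "\<rho> = min r \<delta>"
    have \<rho>: "\<rho> > 0" using r \<delta> by (simp add: \<rho>_def)
    \<comment> \<open>The first bound keeps \<open>v y\<close> close to \<open>u x\<close>, the second keeps \<open>y\<close> within \<open>\<rho>\<close> of \<open>x\<close>.\<close>
    define \<tau> where "\<tau> = min (d / 2) (\<eta> * \<rho>\<^sup>2)"
    have \<tau>: "\<tau> > 0" using d \<eta> \<rho> by (simp add: \<tau>_def)
    have "\<exists>v\<in>perron_class. ?u x - \<tau> < v x"
    proof (rule ccontr)
      assume "\<not> ?thesis"
      then have "?u x \<le> ?u x - \<tau>" by (intro perron_solution_le) force
      then show False using \<tau> by simp
    qed
    then obtain v where v: "v \<in> perron_class" "?u x - \<tau> < v x" by blast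
    have "continuous_on (closure \<Omega>) (\<lambda>y. v y - ?\<psi> y)"
      using v cont by (auto simp: perron_class_def intro!: continuous_intros)
    moreover have "closure \<Omega> \<noteq> {}" using nonempty_domain by simp
    ultimately obtain y where y: "y \<in> closure \<Omega>"
      and max: "\<And>z. z \<in> closure \<Omega> \<Longrightarrow> v z - ?\<psi> z \<le> v y - ?\<psi> y"
      using continuous_attains_sup[OF compact_closure_domain, of "\<lambda>y. v y - ?\<psi> y"] by auto
    have vy: "v y \<le> \<phi> y" using le_perron_solution[OF v(1) y] le y by force
    have low: "- \<tau> < v y - ?\<psi> y" using max[OF x(2)] v(2) eq by simp
    then have "\<eta> * (norm (y - x))\<^sup>2 < \<eta> * \<rho>\<^sup>2" using vy by (simp add: \<tau>_def)
    then have "(norm (y - x))\<^sup>2 < \<rho>\<^sup>2" using \<eta> by simp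
    then have close: "norm (y - x) < \<rho>" using \<rho> by (simp add: power2_less_imp_less)
    have "\<bar>\<phi> y - ?u x\<bar> < d / 2"
      using \<delta>(2)[OF y] close eq by (simp add: \<rho>_def dist_norm)
    moreover have "\<phi> y - v y < d / 2"
    proof -
      have "\<tau> \<le> d / 2" "0 \<le> \<eta> * (norm (y - x))\<^sup>2" using \<eta> by (auto simp: \<tau>_def)
      then show ?thesis using low by linarith
    qed
    ultimately have vd: "\<bar>v y - ?u x\<bar> < d" using vy by linarith
    then have vpos: "0 < v y" using d by linarith
    have ball: "y \<in> ball x r" using close by (simp add: \<rho>_def dist_norm norm_minus_commute)
    have "f (v y) \<le> L ?\<psi> y" using near[OF ball] max vpos by (intro subsolution_max_touch v) auto
    moreover have "L ?\<psi> y < c" using near[OF ball] by blast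
    ultimately show False using d(3)[OF vd] by linarith
  qed
qed

text \<open>
  If the operator exceeded \<open>f (u x)\<close> at a test function touching from below, then lowering that function
  quadratically away from \<open>x\<close> and raising it by \<open>\<tau>\<close> would give \<open>\<psi>\<close> with \<open>\<psi> > u\<close> only near \<open>x\<close>, where \<open>\<psi>\<close> is a
  strict subsolution.  Then \<open>max u \<psi>\<close> is again a competitor, but larger than \<open>u\<close> at \<open>x\<close>.
\<close>
lemma perron_solution_supersolution:
  assumes t: "test_at \<phi> x" and pos: "0 < perron_solution x" and eq: "\<phi> x = perron_solution x"
    and le: "\<And>y. y \<in> closure \<Omega> \<Longrightarrow> \<phi> y \<le> perron_solution y"
  shows "L \<phi> x \<le> f (perron_solution x)"
proof (rule ccontr)
  let ?u = perron_solution
  have x: "x \<in> \<Omega>" "x \<in> closure \<Omega>" and cont: "continuous_on (closure \<Omega>) \<phi>"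
    using t domain_in_closure by (auto simp: test_at_def)
  assume "\<not> ?thesis"
  then obtain c where c: "c < L \<phi> x" "f (?u x) < c" using dense[of "f (?u x)" "L \<phi> x"] by auto
  obtain \<eta> r where \<eta>: "0 < \<eta>" and r: "0 < r"
    and near: "\<And>x'. x' \<in> ball x r \<Longrightarrow> test_at (\<lambda>y. \<phi> y - \<eta> * (norm (y - x))\<^sup>2) x' \<and>
      c < L (\<lambda>y. \<phi> y - \<eta> * (norm (y - x))\<^sup>2) x'"
    using laplacian_greater_perturb[OF t c(1)] by blast
  obtain d where d: "0 < d" "d \<le> ?u x" "\<And>s. \<bar>s - ?u x\<bar> < d \<Longrightarrow> \<bar>f s - f (?u x)\<bar> < c - f (?u x)"
    using f_near[OF pos, of "c - f (?u x)"] c by auto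
  obtain \<delta> where \<delta>: "\<delta> > 0"
    "\<And>y. y \<in> closure \<Omega> \<Longrightarrow> dist y x < \<delta> \<Longrightarrow> dist (?u y) (?u x) < d / 2"
    "\<And>y. y \<in> closure \<Omega> \<Longrightarrow> dist y x < \<delta> \<Longrightarrow> dist (\<phi> y) (\<phi> x) < d / 2"
  proof -
    obtain d1 where "d1 > 0" "\<And>y. y \<in> closure \<Omega> \<Longrightarrow> dist y x < d1 \<Longrightarrow> dist (?u y) (?u x) < d / 2"
      using perron_solution_continuous x d(1) unfolding continuous_on_iff by (meson half_gt_zero)
    moreover obtain d2 where "d2 > 0" "\<And>y. y \<in> closure \<Omega> \<Longrightarrow> dist y x < d2 \<Longrightarrow> dist (\<phi> y) (\<phi> x) < d / 2"
      using cont x d(1) unfolding continuous_on_iff by (meson half_gt_zero)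
    ultimately show thesis using that[of "min d1 d2"] by auto
  qed
  define \<rho> where "\<rho> = min r \<delta>"
  have \<rho>: "\<rho> > 0" using r \<delta> by (simp add: \<rho>_def)
  define \<tau> where "\<tau> = min (d / 2) (\<eta> * \<rho>\<^sup>2)"
  have \<tau>: "\<tau> > 0" using d \<eta> \<rho> by (simp add: \<tau>_def)
  define \<psi> where "\<psi> y = \<phi> y - \<eta> * (norm (y - x))\<^sup>2 + \<tau>" for y
  define v where "v y = max (?u y) (\<psi> y)" for y
  have close: "norm (y - x) < \<rho>" if "y \<in> closure \<Omega>" "?u y < \<psi> y" for y
  proof -
    have "\<eta> * (norm (y - x))\<^sup>2 < \<eta> * \<rho>\<^sup>2" using that le[OF that(1)] by (simp add: \<psi>_def \<tau>_def)
    then have "(norm (y - x))\<^sup>2 < \<rho>\<^sup>2" using \<eta> by simp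
    then show ?thesis using \<rho> by (simp add: power2_less_imp_less)
  qed
  have bump: "test_at \<psi> y \<and> f (\<psi> y) < L \<psi> y" if y: "y \<in> closure \<Omega>" "?u y < \<psi> y" for y
  proof -
    have ball: "y \<in> ball x r" using close[OF y] by (simp add: \<rho>_def dist_norm norm_minus_commute)
    have "test_at \<psi> y"
      unfolding \<psi>_def using near[OF ball] by (intro test_at_add test_at_const) (auto simp: test_at_def)
    moreover have "c < L \<psi> y" unfolding \<psi>_def laplacian_add_const using near[OF ball] by blast
    moreover have "f (\<psi> y) < c"
    proof -
      have "\<bar>?u y - ?u x\<bar> < d / 2" "\<bar>\<phi> y - ?u x\<bar> < d / 2"
        using \<delta>(2,3)[OF y(1)] close[OF y] eq by (auto simp: \<rho>_def dist_norm)
      moreover have "\<psi> y \<le> \<phi> y + d / 2" 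
      proof -
        have "\<tau> \<le> d / 2" "0 \<le> \<eta> * (norm (y - x))\<^sup>2" using \<eta> by (auto simp: \<tau>_def)
        then show ?thesis unfolding \<psi>_def by linarith
      qed
      ultimately have "\<bar>\<psi> y - ?u x\<bar> < d" using y(2) by linarith
      then show ?thesis using d(3)[of "\<psi> y"] by linarith
    qed
    ultimately show ?thesis by linarith
  qed
  have "v \<in> perron_class"
    unfolding perron_class_def
  proof (intro CollectI conjI ballI)
    show "continuous_on (closure \<Omega>) v"
      unfolding v_def \<psi>_def
      by (intro continuous_intros continuous_on_max perron_solution_continuous cont)
    show "0 \<le> v y" if "y \<in> closure \<Omega>" for y
      using perron_solution_nonneg[OF that] by (simp add: v_def)
    show "v y \<le> g y" if "y \<in> frontier \<Omega>" for y
    proof -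
      have "\<not> ?u y < \<psi> y"
        using bump[of y] frontier_in_closure[OF that] domain_not_frontier that by (auto simp: test_at_def)
      then show ?thesis using perron_solution_boundary[OF that] by (simp add: v_def)
    qed
    show "subsolution v"
      unfolding subsolution_def
    proof (intro allI impI, elim conjE)
      fix \<xi> y
      assume t\<xi>: "test_at \<xi> y" and vpos: "0 < v y" and \<xi>y: "\<xi> y = v y" and above: "\<forall>z\<in>closure \<Omega>. v z \<le> \<xi> z"
      have y: "y \<in> closure \<Omega>" using t\<xi> domain_in_closure by (auto simp: test_at_def)
      show "f (v y) \<le> L \<xi> y"
      proof (cases "?u y < \<psi> y")
        case True
        then have "v y = \<psi> y" by (simp add: v_def)
        moreover have "L \<psi> y \<le> L \<xi> y"
          using bump[OF y True] t\<xi> above \<xi>y \<open>v y = \<psi> y\<close> by (intro laplacian_mono) (auto simp: v_def)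
        ultimately show ?thesis using bump[OF y True] by simp
      next
        case False
        then have "v y = ?u y" by (simp add: v_def)
        moreover have "\<forall>z\<in>closure \<Omega>. ?u z \<le> \<xi> z" using above by (force simp: v_def)
        ultimately show ?thesis
          using perron_solution_subsolution t\<xi> vpos \<xi>y unfolding subsolution_def by metis
      qed
    qed
  qed
  from le_perron_solution[OF this x(2)] show False
    using \<tau> eq by (simp add: v_def \<psi>_def)
qed

lemma perron_solution_viscosity: "viscosity_solution \<alpha> \<Omega> f perron_solution"
  unfolding viscosity_solution_def
proof (intro allI impI, elim conjE)
  fix \<phi> x
  assume C1: "C1_on \<Omega> \<phi>" and cont: "continuous_on (closure \<Omega>) \<phi>"
    and x: "x \<in> positivity_set \<Omega> perron_solution" and eq: "perron_solution x = \<phi> x"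
  have pos: "0 < perron_solution x" and x: "x \<in> \<Omega>" using x by (auto simp: positivity_set_def)
  have t: "test_at \<phi> x" using lipschitz_near_if_C1_on[OF open_domain C1 x] cont x by (simp add: test_at_def)
  show "((\<forall>y\<in>closure \<Omega>. perron_solution y \<le> \<phi> y) \<longrightarrow> - L \<phi> x + f (\<phi> x) \<le> 0) \<and>
        ((\<forall>y\<in>closure \<Omega>. perron_solution y \<ge> \<phi> y) \<longrightarrow> - L \<phi> x + f (\<phi> x) \<ge> 0)"
    using perron_solution_subsolution perron_solution_supersolution[OF t pos eq[symmetric]] t pos eq
    unfolding subsolution_def by fastforce
qed

end


section \<open>Existence\<close>

theorem theorem1p2:
  fixes \<Omega> :: "(real ^ 'n) set" and \<alpha> \<beta> :: real
    and f :: "real \<Rightarrow> real" and g :: "real ^ 'n \<Rightarrow> real"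
  assumes "open \<Omega>" and "connected \<Omega>" and "\<Omega> \<noteq> {}" and "bounded \<Omega>"
    and "0 < \<alpha>" and "\<alpha> < 1"
    and "\<forall>t\<ge>0. f t \<ge> 0" and "continuous_on {0..} f" and "mono_on {0..} f"
    and "0 < \<beta>" and "\<beta> < \<alpha>"
    and "holder_on \<beta> (frontier \<Omega>) g" and "\<forall>x\<in>frontier \<Omega>. g x \<ge> 0"
  shows "\<exists>u :: real ^ 'n \<Rightarrow> real.
    (\<forall>x\<in>closure \<Omega>. u x \<ge> 0) \<and>
    holder_on \<beta> (closure \<Omega>) u \<and>
    viscosity_solution \<alpha> \<Omega> f u \<and>
    (\<forall>x\<in>frontier \<Omega>. u x = g x) \<and>
    locally_holder_on \<alpha> \<Omega> u"
proof -
  interpret holder_obstacle \<Omega> \<alpha> \<beta> f g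
    using assms by unfold_locales auto
  show ?thesis
    using perron_solution_nonneg perron_solution_holder perron_solution_viscosity
      perron_solution_boundary perron_solution_locally_holder by blast
qed

end
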